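(* Let $R\in SO_n$. A real skew symmetric matrix $A$ of order $n$ is a real skew symmetric logarithm of $R$ if and only if there exist a real skew symmetric principal logarithm $B$ of $R$, an SVD system of skew symmetric matrices $C_1,\dots,C_s$ all commuting with $B$, and $l_1,\dots,l_s\in\mathbb{Z}$ such that $$A=B+2\pi\sum_{j=1}^s l_jC_j.$$
   Context: $SO_n$ is the group of real orthogonal matrices of order $n$ with determinant $1$. A real skew symmetric logarithm of $R\in SO_n$ is a real skew symmetric matrix $B$ with $\exp(B)=R$; it is called principal if all its (complex) eigenvalues have absolute value in $[0,\pi]$. An SVD system is a set of nonzero real skew symmetric matrices $C_1,\dots,C_s$ of order $n$ such that $C_j^3=-C_j$ for every $j=1,\dots,s$ and $C_jC_h=0$ as soon as $j\neq h$. *)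

theory Defs
  imports "HOL-Analysis.Analysis"
begin

definition special_orthogonal_group :: "(real ^ 'n ^ 'n) set" where
  "special_orthogonal_group = {R. rotation_matrix R}"

definition skew_symmetric :: "real ^ 'n ^ 'n \<Rightarrow> bool" where
  "skew_symmetric A \<longleftrightarrow> transpose A = - A"

(* The library operations * and ^ on the type real^'n^'n act entrywise, hence a
   separate power operation based on the matrix product. *)
primrec matrix_power :: "real ^ 'n ^ 'n \<Rightarrow> nat \<Rightarrow> real ^ 'n ^ 'n" where
  "matrix_power A 0 = mat 1"
| "matrix_power A (Suc k) = A ** matrix_power A k"

definition matrix_exp :: "real ^ 'n ^ 'n \<Rightarrow> real ^ 'n ^ 'n" where
  "matrix_exp A = (\<Sum>k. (1 / fact k) *\<^sub>R matrix_power A k)"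

(* suminf is only meaningful for convergent series; this one always converges. *)
lemma summable_matrix_exp:
  fixes A :: "real ^ 'n ^ 'n"
  shows "summable (\<lambda>k. (1 / fact k) *\<^sub>R matrix_power A k)"
proof -
  have "bilinear ((**) :: real^'n^'n \<Rightarrow> real^'n^'n \<Rightarrow> real^'n^'n)"
    unfolding bilinear_def
    by (auto intro!: linearI simp: matrix_matrix_mult_def vec_eq_iff sum.distrib
        sum_distrib_left distrib_left distrib_right mult_ac)
  then have bb: "bounded_bilinear ((**) :: real^'n^'n \<Rightarrow> real^'n^'n \<Rightarrow> real^'n^'n)"
    by (simp add: bilinear_conv_bounded_bilinear)
  obtain K :: real where K: "\<And>(X :: real^'n^'n) (Y :: real^'n^'n). norm (X ** Y) \<le> norm X * norm Y * K"
    using bounded_bilinear.bounded[OF bb] by auto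
  have bound: "norm (matrix_power A k) \<le> norm (mat 1 :: real^'n^'n) * (norm A * \<bar>K\<bar>) ^ k" for k
  proof (induction k)
    case (Suc k)
    have "norm (matrix_power A (Suc k)) \<le> norm A * norm (matrix_power A k) * K"
      using K by simp
    also have "\<dots> \<le> norm A * norm (matrix_power A k) * \<bar>K\<bar>"
      by (intro mult_left_mono) auto
    also have "\<dots> = (norm A * \<bar>K\<bar>) * norm (matrix_power A k)"
      by simp
    also have "\<dots> \<le> (norm A * \<bar>K\<bar>) * (norm (mat 1 :: real^'n^'n) * (norm A * \<bar>K\<bar>) ^ k)"
      by (intro mult_left_mono Suc.IH) auto
    finally show ?case by (simp add: mult_ac)
  qed simp
  have "summable (\<lambda>k. norm (mat 1 :: real^'n^'n) * (inverse (fact k) * (norm A * \<bar>K\<bar>) ^ k))"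
    by (intro summable_mult summable_exp)
  then show ?thesis
    by (rule summable_comparison_test')
      (use bound in \<open>auto simp: field_simps\<close>)
qed

definition complex_eigenvalue :: "real ^ 'n ^ 'n \<Rightarrow> complex \<Rightarrow> bool" where
  "complex_eigenvalue A \<mu> \<longleftrightarrow>
     (\<exists>v :: complex ^ 'n. v \<noteq> 0 \<and> (\<chi> i j. complex_of_real (A $ i $ j)) *v v = \<mu> *s v)"

definition skew_log :: "real ^ 'n ^ 'n \<Rightarrow> real ^ 'n ^ 'n \<Rightarrow> bool" where
  "skew_log R B \<longleftrightarrow> skew_symmetric B \<and> matrix_exp B = R"

definition principal_skew_log :: "real ^ 'n ^ 'n \<Rightarrow> real ^ 'n ^ 'n \<Rightarrow> bool" where
  "principal_skew_log R B \<longleftrightarrow>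
     skew_log R B \<and> (\<forall>\<mu>. complex_eigenvalue B \<mu> \<longrightarrow> cmod \<mu> \<in> {0..pi})"

(* The system is the family C 1, ..., C s. The case s = 0 (empty system) is allowed;
   for n = 1 it is the only SVD system. The members are pairwise distinct
   automatically: if C j = C h with j \<noteq> h, then C j = - (C j)^3 = 0. *)
definition SVD_system :: "nat \<Rightarrow> (nat \<Rightarrow> real ^ 'n ^ 'n) \<Rightarrow> bool" where
  "SVD_system s C \<longleftrightarrow>
     (\<forall>j\<in>{1..s}. C j \<noteq> 0 \<and> skew_symmetric (C j) \<and> matrix_power (C j) 3 = - C j) \<and>
     (\<forall>j\<in>{1..s}. \<forall>h\<in>{1..s}. j \<noteq> h \<longrightarrow> C j ** C h = 0)"

end

theory Submission
  imports Defs
begin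

text \<open>
  A skew symmetric matrix \<open>A\<close> is a combination \<open>\<Sum> \<theta>\<^sub>j C\<^sub>j\<close> of an SVD system: if \<open>v\<close> maximises
  \<open>norm (A v)\<close> on the unit sphere, with maximum \<open>\<lambda>\<close>, and \<open>u = A v / \<lambda>\<close>, then \<open>A u = - \<lambda> v\<close>, so that
  subtracting \<open>\<lambda> (u v\<^sup>T - v u\<^sup>T)\<close> from \<open>A\<close> enlarges the kernel. Since \<open>C\<^sup>3 = - C\<close> gives
  \<open>exp (t C) = 1 + sin t C + (1 - cos t) C\<^sup>2\<close>, adding integer multiples of \<open>2 \<pi> C\<^sub>j\<close> to a matrix
  commuting with the \<open>C\<^sub>j\<close> does not change its exponential. This is one direction; for the other,
  reduce every \<open>\<theta>\<^sub>j\<close> modulo \<open>2 \<pi>\<close> to the interval \<open>[-\<pi>, \<pi>]\<close>.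
\<close>

section \<open>Matrix algebra\<close>

text \<open>As \<open>*\<close> is entrywise on this type, the ring rules do not speak about
  \<open>**\<close>; the interpretation supplies distributivity and compatibility with scalars and
  finite sums.\<close>

interpretation matrix_mult: bounded_bilinear
  "(**) :: real^'n^'n \<Rightarrow> real^'n^'n \<Rightarrow> real^'n^'n"
proof -
  have "bilinear ((**) :: real^'n^'n \<Rightarrow> real^'n^'n \<Rightarrow> real^'n^'n)"
    unfolding bilinear_def
    by (auto intro!: linearI simp: matrix_matrix_mult_def vec_eq_iff sum.distrib
        sum_distrib_left distrib_left distrib_right mult_ac)
  then show "bounded_bilinear ((**) :: real^'n^'n \<Rightarrow> real^'n^'n \<Rightarrow> real^'n^'n)"
    by (simp add: bilinear_conv_bounded_bilinear)
qed

lemma linear_transpose: "linear (transpose :: real^'n^'m \<Rightarrow> real^'m^'n)"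
  by (rule linearI) (simp_all add: transpose_def vec_eq_iff)

lemma skew_symmetric_diff:
  "skew_symmetric A \<Longrightarrow> skew_symmetric B \<Longrightarrow> skew_symmetric (A - B)"
  by (simp add: skew_symmetric_def linear_diff[OF linear_transpose])

lemma skew_symmetric_scaleR: "skew_symmetric A \<Longrightarrow> skew_symmetric (c *\<^sub>R A)"
  by (simp add: skew_symmetric_def transpose_scalar)

lemma skew_symmetric_sum:
  "(\<And>j. j \<in> J \<Longrightarrow> skew_symmetric (A j)) \<Longrightarrow> skew_symmetric (\<Sum>j\<in>J. A j)"
  by (simp add: skew_symmetric_def linear_sum[OF linear_transpose] sum_negf)

lemma skew_symmetric_inner:
  assumes "skew_symmetric A"
  shows "(A *v x) \<bullet> y = - (x \<bullet> (A *v y))"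
proof -
  have "x \<bullet> (A *v y) = (transpose A *v x) \<bullet> y"
    by (simp add: dot_lmul_matrix)
  also have "\<dots> = - ((A *v x) \<bullet> y)"
    using assms
    by (simp only: skew_symmetric_def) (simp add: matrix_vector_mult_def inner_vec_def sum_negf)
  finally show ?thesis by simp
qed

lemma matrix_vector_mult_uminus: "(- A) *v x = - (A *v x)"
  for A :: "real^'n^'m"
  by (simp add: matrix_vector_mult_def vec_eq_iff sum_negf)

lemma matrix_power_3_eq: "matrix_power C 3 = C ** (C ** C)"
  by (simp add: eval_nat_numeral)

section \<open>The matrix exponential\<close>

text \<open>Provides a majorant: the exponential series of the matrix of absolute values converges,
  so every entry of the series for \<open>A\<close> converges absolutely.\<close>

lemma abs_matrix_power_entry_le:
  "\<bar>matrix_power A k $ i $ j\<bar> \<le> matrix_power (\<chi> i j. \<bar>A $ i $ j\<bar>) k $ i $ j"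
proof (induction k arbitrary: i j)
  case 0
  show ?case by (simp add: mat_def)
next
  case (Suc k)
  show ?case
    by (auto simp: matrix_matrix_mult_def abs_mult
        intro!: order_trans[OF sum_abs] sum_mono mult_left_mono Suc)
qed

lemma sums_matrix_entry: "f sums L \<Longrightarrow> (\<lambda>k. f k $ i $ j) sums (L $ i $ j)"
  for f :: "nat \<Rightarrow> real^'n^'m"
  by (intro bounded_linear.sums[OF bounded_linear_vec_nth])

definition exp_term :: "real^'n^'n \<Rightarrow> nat \<Rightarrow> real^'n^'n" where
  "exp_term A k = (1 / fact k) *\<^sub>R matrix_power A k"

lemma exp_term_0 [simp]: "exp_term A 0 = mat 1"
  by (simp add: exp_term_def)

lemma mult_exp_term: "A ** exp_term A k = real (Suc k) *\<^sub>R exp_term A (Suc k)"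
  by (simp add: exp_term_def matrix_mult.scaleR_right del: of_nat_Suc)

lemma exp_term_sums: "exp_term A sums matrix_exp A"
  using summable_matrix_exp[of A] unfolding exp_term_def[abs_def] matrix_exp_def
  by (rule summable_sums)

lemma summable_abs_exp_term: "summable (\<lambda>k. \<bar>exp_term A k $ i $ j\<bar>)"
proof (rule summable_comparison_test')
  show "summable (\<lambda>k. exp_term (\<chi> i j. \<bar>A $ i $ j\<bar>) k $ i $ j)"
    using sums_matrix_entry[OF exp_term_sums] by (rule sums_summable)
  show "norm \<bar>exp_term A k $ i $ j\<bar> \<le> exp_term (\<chi> i j. \<bar>A $ i $ j\<bar>) k $ i $ j" for k
    using abs_matrix_power_entry_le[of A k i j]
    by (simp add: exp_term_def abs_mult divide_right_mono)
qed

lemma exp_term_commute: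
  assumes "X ** Y = Y ** X"
  shows "exp_term X n ** Y = Y ** exp_term X n"
proof -
  have "matrix_power X n ** Y = Y ** matrix_power X n"
  proof (induction n)
    case (Suc n)
    have "matrix_power X (Suc n) ** Y = X ** (Y ** matrix_power X n)"
      by (simp add: Suc flip: matrix_mul_assoc)
    then show ?case by (simp add: matrix_mul_assoc assms)
  qed simp
  then show ?thesis
    by (simp add: exp_term_def matrix_mult.scaleR_left matrix_mult.scaleR_right)
qed

text \<open>The binomial theorem with the factorials absorbed into the terms. After multiplication
  by \<open>Suc n\<close>, the recurrence \<open>mult_exp_term\<close> takes the place of Pascal's
  rule, and the weights combine as \<open>i + (Suc n - i) = Suc n\<close>.\<close>

lemma exp_term_add:
  assumes "X ** Y = Y ** X"
  shows "exp_term (X + Y) n = (\<Sum>i\<le>n. exp_term X i ** exp_term Y (n - i))"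
proof (induction n)
  case 0
  show ?case by simp
next
  case (Suc n)
  let ?P = "\<lambda>i j. exp_term X i ** exp_term Y j"
  have X: "X ** ?P i j = real (Suc i) *\<^sub>R ?P (Suc i) j" for i j
    by (simp add: matrix_mul_assoc mult_exp_term matrix_mult.scaleR_left)
  have Y: "Y ** ?P i j = real (Suc j) *\<^sub>R ?P i (Suc j)" for i j
  proof -
    have "Y ** ?P i j = exp_term X i ** (Y ** exp_term Y j)"
      by (simp add: matrix_mul_assoc exp_term_commute[OF assms])
    then show ?thesis by (simp add: mult_exp_term matrix_mult.scaleR_right)
  qed
  have "real (Suc n) *\<^sub>R exp_term (X + Y) (Suc n) = (X + Y) ** (\<Sum>i\<le>n. ?P i (n - i))"
    by (simp only: mult_exp_term[symmetric] Suc)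
  also have "\<dots> = (\<Sum>i\<le>n. real (Suc i) *\<^sub>R ?P (Suc i) (n - i))
                + (\<Sum>i\<le>n. real (Suc n - i) *\<^sub>R ?P i (Suc n - i))"
    by (simp add: matrix_mult.add_left matrix_mult.sum_right X Y Suc_diff_le sum.distrib
        del: of_nat_Suc)
  \<comment> \<open>Both sums extend to the range \<open>i \<le> Suc n\<close>, since the new term
    has weight 0: at \<open>i = 0\<close> in this one, at \<open>i = Suc n\<close> in the
    other.\<close>
  also have "(\<Sum>i\<le>n. real (Suc i) *\<^sub>R ?P (Suc i) (n - i))
           = (\<Sum>i\<le>Suc n. real i *\<^sub>R ?P i (Suc n - i))"
    by (subst sum.atMost_Suc_shift) simp
  also have "(\<Sum>i\<le>n. real (Suc n - i) *\<^sub>R ?P i (Suc n - i))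
           = (\<Sum>i\<le>Suc n. real (Suc n - i) *\<^sub>R ?P i (Suc n - i))"
    by simp
  also have "(\<Sum>i\<le>Suc n. real i *\<^sub>R ?P i (Suc n - i))
           + (\<Sum>i\<le>Suc n. real (Suc n - i) *\<^sub>R ?P i (Suc n - i))
           = real (Suc n) *\<^sub>R (\<Sum>i\<le>Suc n. ?P i (Suc n - i))"
    unfolding scaleR_right.sum
    by (simp flip: sum.distrib scaleR_add_left of_nat_add)
  finally show ?case
    by (simp del: sum.cl_ivl_Suc of_nat_Suc)
qed

text \<open>Each entry of the product is a finite sum of products of absolutely convergent real
  series, to which the Cauchy product applies; \<open>exp_term_add\<close> identifies the
  convolution.\<close>

lemma matrix_exp_add_commuting:
  assumes "X ** Y = Y ** X"
  shows "matrix_exp (X + Y) = matrix_exp X ** matrix_exp Y"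
proof -
  have "(matrix_exp X ** matrix_exp Y) $ i $ j = matrix_exp (X + Y) $ i $ j" for i j
  proof -
    have "(\<lambda>k. \<Sum>m\<in>UNIV. \<Sum>p\<le>k. exp_term X p $ i $ m * exp_term Y (k - p) $ m $ j) sums
      (\<Sum>m\<in>UNIV. (\<Sum>k. exp_term X k $ i $ m) * (\<Sum>k. exp_term Y k $ m $ j))"
      by (intro sums_sum Cauchy_product_sums) (simp_all add: summable_abs_exp_term)
    also have "(\<lambda>k. \<Sum>m\<in>UNIV. \<Sum>p\<le>k. exp_term X p $ i $ m * exp_term Y (k - p) $ m $ j)
      = (\<lambda>k. exp_term (X + Y) k $ i $ j)"
      unfolding exp_term_add[OF assms]
      by (subst sum.swap) (simp add: matrix_matrix_mult_def)
    also have "(\<Sum>m\<in>UNIV. (\<Sum>k. exp_term X k $ i $ m) * (\<Sum>k. exp_term Y k $ m $ j))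
      = (matrix_exp X ** matrix_exp Y) $ i $ j"
      by (simp add: matrix_matrix_mult_def
          sums_unique[OF sums_matrix_entry[OF exp_term_sums], symmetric])
    finally show ?thesis
      using sums_matrix_entry[OF exp_term_sums] by (rule sums_unique2)
  qed
  then show ?thesis by (simp add: vec_eq_iff)
qed

section \<open>Closed form of the exponential when \<open>C ** (C ** C) = - C\<close>\<close>

text \<open>The powers of \<open>C\<close> cycle through \<open>C\<close>, \<open>C\<^sup>2\<close>,
  \<open>- C\<close>, \<open>- C\<^sup>2\<close>, which produces the sine and cosine coefficients.
  At \<open>n = 0\<close> this pattern would give \<open>- (C ** C)\<close>; the conditional summand
  corrects it to \<open>mat 1\<close>.\<close>

lemma exp_term_scaleR_cube_eq_minus:
  assumes "C ** (C ** C) = - C"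
  shows "exp_term (t *\<^sub>R C) n = (if n = 0 then mat 1 + C ** C else 0)
    + (sin_coeff n * t ^ n) *\<^sub>R C - (cos_coeff n * t ^ n) *\<^sub>R (C ** C)"
proof (induction n)
  case 0
  show ?case by simp
next
  case (Suc n)
  have "real (Suc n) *\<^sub>R exp_term (t *\<^sub>R C) (Suc n) = (t *\<^sub>R C) ** exp_term (t *\<^sub>R C) n"
    by (simp only: mult_exp_term)
  \<comment> \<open>The correction from \<open>n = 0\<close> disappears because
    \<open>C ** (mat 1 + C ** C) = 0\<close>.\<close>
  also have "\<dots> = (sin_coeff n * t ^ Suc n) *\<^sub>R (C ** C) + (cos_coeff n * t ^ Suc n) *\<^sub>R C"
    unfolding Suc
    by (simp add: matrix_mult.scaleR_left matrix_mult.scaleR_right matrix_mult.add_right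
        matrix_mult.diff_right assms algebra_simps)
  finally have "exp_term (t *\<^sub>R C) (Suc n) = (1 / real (Suc n)) *\<^sub>R
      ((sin_coeff n * t ^ Suc n) *\<^sub>R (C ** C) + (cos_coeff n * t ^ Suc n) *\<^sub>R C)"
    by (metis (no_types) divide_inverse_commute mult_1_right nat.distinct(1) of_nat_eq_0_iff
        scaleR_one scaleR_scaleR left_inverse)
  then show ?case
    by (simp add: sin_coeff_Suc cos_coeff_Suc scaleR_add_right del: of_nat_Suc)
qed

text \<open>Rodrigues' rotation formula, by summing the sine and cosine series.\<close>

lemma matrix_exp_scaleR_cube_eq_minus:
  assumes "C ** (C ** C) = - C"
  shows "matrix_exp (t *\<^sub>R C) = mat 1 + sin t *\<^sub>R C + (1 - cos t) *\<^sub>R (C ** C)"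
proof -
  have "exp_term (t *\<^sub>R C) sums
      ((mat 1 + C ** C) + sin t *\<^sub>R C - cos t *\<^sub>R (C ** C))"
    unfolding exp_term_scaleR_cube_eq_minus[OF assms]
    by (intro sums_add sums_diff sums_scaleR_left sums_single
        sin_converges[of t, unfolded real_scaleR_def] cos_converges[of t, unfolded real_scaleR_def])
  with exp_term_sums have "matrix_exp (t *\<^sub>R C) =
      (mat 1 + C ** C) + sin t *\<^sub>R C - cos t *\<^sub>R (C ** C)"
    by (rule sums_unique2)
  then show ?thesis by (simp add: algebra_simps)
qed

lemma matrix_exp_two_pi_int:
  assumes "C ** (C ** C) = - C"
  shows "matrix_exp ((2 * pi * of_int l) *\<^sub>R C) = mat 1"
  using matrix_exp_scaleR_cube_eq_minus[OF assms, of "2 * pi * of_int l"]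
  by (simp add: sin_int_2pin cos_int_2pin)

text \<open>The shifts commute with \<open>B\<close> and with one another, so they split off one at
  a time, each with factor \<open>mat 1\<close>.\<close>

lemma matrix_exp_add_two_pi_ints:
  assumes "finite J" and "\<And>j. j \<in> J \<Longrightarrow> C j ** (C j ** C j) = - C j"
    and "\<And>j. j \<in> J \<Longrightarrow> C j ** B = B ** C j"
    and "\<And>i j. i \<in> J \<Longrightarrow> j \<in> J \<Longrightarrow> C i ** C j = C j ** C i"
  shows "matrix_exp (B + (\<Sum>j\<in>J. (2 * pi * of_int (l j)) *\<^sub>R C j)) = matrix_exp B"
  using assms
proof (induction J rule: finite_induct)
  case empty
  then show ?case by simp
next
  case (insert k J)
  let ?M = "B + (\<Sum>j\<in>J. (2 * pi * of_int (l j)) *\<^sub>R C j)"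
  have "?M ** C k = C k ** ?M"
    using insert.prems(2,3)
    by (simp add: matrix_mult.add_left matrix_mult.add_right matrix_mult.sum_left
        matrix_mult.sum_right matrix_mult.scaleR_left matrix_mult.scaleR_right)
  then have "matrix_exp (?M + (2 * pi * of_int (l k)) *\<^sub>R C k) = matrix_exp ?M ** mat 1"
    using insert.prems(1)[of k]
    by (subst matrix_exp_add_commuting)
      (simp_all add: matrix_exp_two_pi_int matrix_mult.scaleR_left matrix_mult.scaleR_right)
  also have "\<dots> = matrix_exp B"
    using insert by simp
  finally show ?case
    using insert.hyps by (simp add: add_ac)
qed

section \<open>Spectral decomposition of skew symmetric matrices\<close>

text \<open>Equality case of Cauchy-Schwarz, in place of Lagrange multipliers: with
  \<open>m = norm (A *v v)\<close>, the vector \<open>A *v (A *v v)\<close> has norm at most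
  \<open>m\<^sup>2\<close> and inner product \<open>- m\<^sup>2\<close> with the unit vector
  \<open>v\<close>.\<close>

lemma skew_symmetric_max_vector:
  assumes "skew_symmetric A" and "norm v = 1" and "\<And>x. norm (A *v x) \<le> norm (A *v v) * norm x"
  shows "A *v (A *v v) = - ((norm (A *v v))\<^sup>2 *\<^sub>R v)"
proof -
  let ?m = "norm (A *v v)" and ?w = "A *v (A *v v)"
  have vw: "?w \<bullet> v = - ?m\<^sup>2"
    by (simp add: skew_symmetric_inner[OF assms(1)] power2_norm_eq_inner)
  have "(norm ?w)\<^sup>2 \<le> (?m * ?m)\<^sup>2"
    using assms(3) by (intro power_mono) auto
  moreover have "(norm (?w + c *\<^sub>R v))\<^sup>2 = (norm ?w)\<^sup>2 + 2 * c * (?w \<bullet> v) + c\<^sup>2 * (norm v)\<^sup>2" for c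
    unfolding power2_norm_eq_inner
    by (simp add: inner_add_left inner_add_right inner_commute[of v ?w] power2_eq_square algebra_simps)
  \<comment> \<open>The choice \<open>c = ?m\<^sup>2\<close> bounds the expansion by m^4 - 2 m^4 +
    m^4 = 0.\<close>
  ultimately have "(norm (?w + ?m\<^sup>2 *\<^sub>R v))\<^sup>2 \<le> 0"
    using vw assms(2) by (simp add: power2_eq_square)
  then have "?w + ?m\<^sup>2 *\<^sub>R v = 0" by simp
  then show ?thesis by (simp add: eq_neg_iff_add_eq_0)
qed

text \<open>For orthonormal \<open>u\<close> and \<open>v\<close> this is the quarter turn taking
  \<open>v\<close> to \<open>u\<close> and \<open>u\<close> to \<open>- v\<close>, and zero on the
  orthogonal complement of their plane.\<close>

definition rotation_generator :: "real^'n \<Rightarrow> real^'n \<Rightarrow> real^'n^'n" where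
  "rotation_generator u v = (\<chi> i j. u $ i * v $ j - v $ i * u $ j)"

lemma skew_symmetric_rotation_generator: "skew_symmetric (rotation_generator u v)"
  by (simp add: skew_symmetric_def rotation_generator_def transpose_def vec_eq_iff)

lemma rotation_generator_mult:
  "rotation_generator u v *v x = (v \<bullet> x) *\<^sub>R u - (u \<bullet> x) *\<^sub>R v"
  by (simp add: rotation_generator_def matrix_vector_mult_def vec_eq_iff inner_vec_def
      algebra_simps sum_subtractf sum_distrib_left)

lemma rotation_generator_cube:
  assumes "norm u = 1" "norm v = 1" "u \<bullet> v = 0"
  shows "matrix_power (rotation_generator u v) 3 = - rotation_generator u v"
proof -
  have "matrix_power (rotation_generator u v) 3 *v x = (- rotation_generator u v) *v x" for x
    using assms
    by (simp add: matrix_power_3_eq matrix_vector_mult_uminus rotation_generator_mult inner_diff_right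
        inner_commute[of v u] norm_eq_1 algebra_simps flip: matrix_vector_mul_assoc)
  then show ?thesis by (simp add: matrix_eq)
qed

lemma skew_symmetric_invariant_plane:
  assumes A: "skew_symmetric A" and "A \<noteq> 0"
  obtains c u v where "norm u = 1" "norm v = 1" "u \<bullet> v = 0"
    "A *v v = c *\<^sub>R u" "A *v u = - (c *\<^sub>R v)" "c > 0"
proof -
  obtain x\<^sub>0 where x0: "A *v x\<^sub>0 \<noteq> 0"
    using \<open>A \<noteq> 0\<close> by (metis matrix_eq matrix_vector_mult_0)
  then have "x\<^sub>0 \<noteq> 0" by auto
  have "\<exists>v\<in>sphere 0 1. \<forall>y\<in>sphere 0 1. norm (A *v y) \<le> norm (A *v v)"
    using \<open>x\<^sub>0 \<noteq> 0\<close>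
    by (intro continuous_attains_sup continuous_on_norm linear_continuous_on) auto
  then obtain v where v: "norm v = 1"
    and max: "\<And>y. norm y = 1 \<Longrightarrow> norm (A *v y) \<le> norm (A *v v)"
    by auto
  let ?c = "norm (A *v v)"
  have bound: "norm (A *v x) \<le> ?c * norm x" for x
  proof (cases "x = 0")
    case False
    then show ?thesis
      using max[of "(1 / norm x) *\<^sub>R x"] by (simp add: matrix_vector_mult_scaleR field_simps)
  qed simp
  have c: "?c > 0"
    using bound[of x\<^sub>0] x0 by auto
  define u where "u = (1 / ?c) *\<^sub>R (A *v v)"
  have "(A *v v) \<bullet> v = 0"
    using skew_symmetric_inner[OF A, of v v] by (simp add: inner_commute)
  then show ?thesis
    using c v skew_symmetric_max_vector[OF A v bound]
    by (intro that[of u v ?c])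
      (auto simp: u_def matrix_vector_mult_scaleR power2_eq_square)
qed

lemma skew_symmetric_decomposition:
  fixes A :: "real^'n^'n"
  assumes "skew_symmetric A"
  obtains s C \<theta> where "SVD_system s C" "A = (\<Sum>j=1..s. \<theta> j *\<^sub>R C j)"
proof -
  \<comment> \<open>The kernel clause strengthens the induction: it makes the matrices found for the
    remainder annihilate the plane split off before.\<close>
  have "\<exists>s C \<theta>. SVD_system s C \<and> A = (\<Sum>j=1..s. \<theta> j *\<^sub>R C j) \<and>
      (\<forall>j\<in>{1..s}. \<forall>x. A *v x = 0 \<longrightarrow> C j *v x = 0)"
    using assms
  \<comment> \<open>The measure is the rank of \<open>A\<close>.\<close>
  proof (induction "DIM(real^'n) - dim {x. A *v x = 0}" arbitrary: A rule: less_induct)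
    case less
    show ?case
    proof (cases "A = 0")
      case True
      then have "SVD_system 0 (\<lambda>_. A)" by (simp add: SVD_system_def)
      with True show ?thesis by (intro exI[of _ 0] exI[of _ "\<lambda>_. A"]) simp
    next
      case False
      obtain c u v where uv: "norm u = 1" "norm v = 1" "u \<bullet> v = 0"
        and Av: "A *v v = c *\<^sub>R u" and Au: "A *v u = - (c *\<^sub>R v)" and c: "c > 0"
        using skew_symmetric_invariant_plane[OF less.prems False] .
      define D where "D = rotation_generator u v"
      define A' where "A' = A - c *\<^sub>R D"
      have D: "D *v x = (v \<bullet> x) *\<^sub>R u - (u \<bullet> x) *\<^sub>R v" for x
        by (simp add: D_def rotation_generator_mult)
      have skD: "skew_symmetric D"
        by (simp add: D_def skew_symmetric_rotation_generator)
      have A'x: "A' *v x = A *v x - c *\<^sub>R (D *v x)" for x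
        by (simp add: A'_def matrix_vector_mult_diff_rdistrib scaleR_matrix_vector_assoc)
      \<comment> \<open>The vectors \<open>u\<close> and \<open>v\<close> lie in the range of
        \<open>A\<close>, which is orthogonal to its kernel.\<close>
      have kerD: "D *v x = 0" if "A *v x = 0" for x
      proof -
        have "(c *\<^sub>R u) \<bullet> x = 0" "(c *\<^sub>R v) \<bullet> x = 0"
          using skew_symmetric_inner[OF less.prems, of v x]
            skew_symmetric_inner[OF less.prems, of u x] that Av Au by auto
        with c show ?thesis by (simp add: D)
      qed
      have ker: "A' *v x = 0" if "A *v x = 0" for x
        using kerD[OF that] that by (simp add: A'x)
      have A'uv: "A' *v u = 0" "A' *v v = 0"
        using uv by (simp_all add: A'x D Av Au norm_eq_1 inner_commute[of v u])
      \<comment> \<open>The vector \<open>v\<close> witnesses that the kernel grows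
        strictly.\<close>
      have "A *v v \<noteq> 0"
        using c uv(1) by (auto simp: Av)
      then have "{x. A *v x = 0} \<subset> {x. A' *v x = 0}"
        using ker A'uv by blast
      then have "dim {x. A *v x = 0} < dim {x. A' *v x = 0}"
        by (intro dim_psubset) (simp add: span_eq_iff[THEN iffD2] subspace_def matrix_vector_right_distrib matrix_vector_mult_scaleR)
      moreover have "dim {x. A' *v x = 0} \<le> DIM(real^'n)"
        by (rule dim_subset_UNIV)
      ultimately have "DIM(real^'n) - dim {x. A' *v x = 0} < DIM(real^'n) - dim {x. A *v x = 0}"
        by linarith
      moreover have "skew_symmetric A'"
        unfolding A'_def by (intro skew_symmetric_diff skew_symmetric_scaleR less.prems skD)
      ultimately obtain s C \<theta> where C: "SVD_system s C" and sum: "A' = (\<Sum>j=1..s. \<theta> j *\<^sub>R C j)"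
        and kerC: "\<forall>j\<in>{1..s}. \<forall>x. A' *v x = 0 \<longrightarrow> C j *v x = 0"
        using less.hyps by blast
      \<comment> \<open>The range of \<open>D\<close> is spanned by \<open>u\<close> and
        \<open>v\<close>, which \<open>A'\<close> and hence every \<open>C j\<close>
        annihilates.\<close>
      have CD: "C j ** D = 0" if "j \<in> {1..s}" for j
        using kerC A'uv that
        by (simp add: matrix_eq D matrix_vector_mult_diff_distrib matrix_vector_mult_scaleR
            flip: matrix_vector_mul_assoc)
      \<comment> \<open>Transposing a product of two skew symmetric matrices only swaps the
        factors.\<close>
      have DC: "D ** C j = 0" if "j \<in> {1..s}" for j
      proof -
        have "D ** C j = transpose (C j ** D)"
          using C skD that
          by (simp add: matrix_transpose_mul SVD_system_def skew_symmetric_def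
              matrix_mult.minus_left matrix_mult.minus_right)
        then show ?thesis using CD[OF that] by (simp add: transpose_def vec_eq_iff)
      qed
      have "D *v v \<noteq> 0"
        using uv by (simp add: D norm_eq_1) auto
      then have "D \<noteq> 0" by auto
      moreover have "matrix_power D 3 = - D"
        unfolding D_def by (rule rotation_generator_cube[OF uv])
      ultimately have "SVD_system (Suc s) (C(Suc s := D))"
        using C skD CD DC by (auto simp: SVD_system_def le_Suc_eq)
      moreover have "A = (\<Sum>j=1..Suc s. (\<theta>(Suc s := c)) j *\<^sub>R (C(Suc s := D)) j)"
      proof -
        have "A = A' + c *\<^sub>R D" by (simp add: A'_def)
        then show ?thesis by (simp add: sum)
      qed
      moreover have "\<forall>j\<in>{1..Suc s}. \<forall>x. A *v x = 0 \<longrightarrow> (C(Suc s := D)) j *v x = 0"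
        using kerC kerD ker by (auto simp: le_Suc_eq)
      ultimately show ?thesis by blast
    qed
  qed
  then show ?thesis using that by blast
qed

section \<open>Eigenvalue bounds\<close>

text \<open>Being real, \<open>B\<close> acts separately on the real and imaginary parts of an
  eigenvector, and the squared norms of the parts add up; so a bound on real vectors passes to
  complex ones.\<close>

lemma cmod_complex_eigenvalue_le:
  fixes B :: "real^'n^'n"
  assumes bound: "\<And>x. norm (B *v x) \<le> M * norm x" and "complex_eigenvalue B \<mu>"
  shows "cmod \<mu> \<le> M"
proof -
  obtain v :: "complex^'n" where v: "v \<noteq> 0"
    and ev: "(\<chi> i j. complex_of_real (B $ i $ j)) *v v = \<mu> *s v"
    using assms(2) by (auto simp: complex_eigenvalue_def)
  let ?x = "\<chi> i. Re (v $ i)" and ?y = "\<chi> i. Im (v $ i)"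
  have split: "(norm w)\<^sup>2 = (norm (\<chi> i. Re (w $ i)))\<^sup>2 + (norm (\<chi> i. Im (w $ i)))\<^sup>2"
    for w :: "complex^'n"
    by (simp add: norm_vec_def L2_set_def sum_nonneg cmod_power2 sum.distrib)
  have Re: "(\<chi> i. Re ((\<mu> *s v) $ i)) = B *v ?x" and Im: "(\<chi> i. Im ((\<mu> *s v) $ i)) = B *v ?y"
    unfolding ev[symmetric] by (simp_all add: matrix_vector_mult_def vec_eq_iff)
  have M: "0 \<le> M"
    using bound[of "axis undefined 1"] order_trans[OF norm_ge_zero]
    by (simp add: norm_axis_1)
  have "(cmod \<mu> * norm v)\<^sup>2 = (norm (\<mu> *s v))\<^sup>2"
    by (simp add: norm_vec_def L2_set_def norm_mult power_mult_distrib sum_nonneg sum_distrib_left)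
  also have "\<dots> = (norm (B *v ?x))\<^sup>2 + (norm (B *v ?y))\<^sup>2"
    by (simp only: split[of "\<mu> *s v"] Re Im)
  also have "\<dots> \<le> (M * norm ?x)\<^sup>2 + (M * norm ?y)\<^sup>2"
    by (intro add_mono power_mono bound) auto
  also have "\<dots> = (M * norm v)\<^sup>2"
    by (simp add: power_mult_distrib split[of v] distrib_left)
  finally have "cmod \<mu> * norm v \<le> M * norm v"
    using M by (simp add: power2_le_iff_abs_le)
  then show ?thesis using v by simp
qed

section \<open>Norm estimates for combinations of an SVD system\<close>

lemma SVD_system_inner:
  assumes "SVD_system s C" "i \<in> {1..s}" "j \<in> {1..s}" "i \<noteq> j"
  shows "(C i *v x) \<bullet> (C j *v y) = 0"
  using assms by (simp add: SVD_system_def skew_symmetric_inner matrix_vector_mul_assoc)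

lemma SVD_system_norm_sum_scaleR:
  assumes "SVD_system s C"
  shows "(norm (\<Sum>j=1..s. r j *\<^sub>R (C j *v x)))\<^sup>2 = (\<Sum>j=1..s. (r j)\<^sup>2 * (norm (C j *v x))\<^sup>2)"
proof -
  have "(norm (\<Sum>j=1..s. r j *\<^sub>R (C j *v x)))\<^sup>2 = (\<Sum>j=1..s. (norm (r j *\<^sub>R (C j *v x)))\<^sup>2)"
    using assms by (intro norm_sum_Pythagorean)
      (auto simp: pairwise_def orthogonal_def SVD_system_inner)
  then show ?thesis by (simp add: power_mult_distrib)
qed

text \<open>The matrices \<open>- C\<^sub>j\<^sup>2\<close> are orthogonal projections onto mutually orthogonal subspaces, so this
  is Bessel's inequality.\<close>

lemma SVD_system_Bessel:
  assumes "SVD_system s C"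
  shows "(\<Sum>j=1..s. (norm (C j *v x))\<^sup>2) \<le> (norm x)\<^sup>2"
proof -
  let ?S = "\<Sum>j=1..s. C j *v (C j *v x)" and ?t = "\<Sum>j=1..s. (norm (C j *v x))\<^sup>2"
  have sk: "skew_symmetric (C j)" and cube: "C j ** (C j ** C j) = - C j"
    if "j \<in> {1..s}" for j
    using assms that by (auto simp: SVD_system_def matrix_power_3_eq)
  have 1: "x \<bullet> (C j *v (C j *v x)) = - (norm (C j *v x))\<^sup>2" if "j \<in> {1..s}" for j
    using skew_symmetric_inner[OF sk[OF that], of x "C j *v x"]
    by (simp add: power2_norm_eq_inner)
  have 2: "(norm (C j *v (C j *v x)))\<^sup>2 = (norm (C j *v x))\<^sup>2" if "j \<in> {1..s}" for j
  proof -
    have "C j *v (C j *v (C j *v x)) = - (C j *v x)"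
      by (simp add: matrix_vector_mul_assoc cube[OF that] matrix_vector_mult_uminus
          flip: matrix_mul_assoc)
    then show ?thesis
      using skew_symmetric_inner[OF sk[OF that], of "C j *v x" "C j *v (C j *v x)"]
      by (simp add: power2_norm_eq_inner)
  qed
  have "(norm ?S)\<^sup>2 = (\<Sum>j=1..s. (norm (C j *v (C j *v x)))\<^sup>2)"
    using assms by (intro norm_sum_Pythagorean)
      (auto simp: pairwise_def orthogonal_def SVD_system_inner)
  also have "\<dots> = ?t" using 2 by simp
  finally have "(norm ?S)\<^sup>2 = ?t" .
  moreover have "x \<bullet> ?S = - ?t"
    using 1 by (simp add: inner_sum_right sum_negf)
  \<comment> \<open>Here \<open>x + ?S\<close> is the component of \<open>x\<close> orthogonal to
    all ranges; its squared norm is that of \<open>x\<close> minus \<open>?t\<close>.\<close>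
  moreover have "(norm (x + ?S))\<^sup>2 = (norm x)\<^sup>2 + 2 * (x \<bullet> ?S) + (norm ?S)\<^sup>2"
    by (simp add: power2_norm_eq_inner inner_add_left inner_add_right inner_commute)
  ultimately show ?thesis
    using zero_le_power2[of "norm (x + ?S)"] by linarith
qed

text \<open>The summands are orthogonal, so Bessel's inequality applies after replacing each
  coefficient by \<open>M\<close>. With \<open>M = pi\<close> this controls the eigenvalues of the
  reduced matrix.\<close>

lemma SVD_system_norm_le:
  assumes "SVD_system s C" and r: "\<And>j. j \<in> {1..s} \<Longrightarrow> \<bar>r j\<bar> \<le> M" and "0 \<le> M"
  shows "norm ((\<Sum>j=1..s. r j *\<^sub>R C j) *v x) \<le> M * norm x"
proof -
  have "(\<Sum>j=1..s. r j *\<^sub>R C j) *v x = (\<Sum>j=1..s. r j *\<^sub>R (C j *v x))"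
    by (induction s) (simp_all add: matrix_vector_mult_add_rdistrib scaleR_matrix_vector_assoc)
  then have "(norm ((\<Sum>j=1..s. r j *\<^sub>R C j) *v x))\<^sup>2
      = (\<Sum>j=1..s. (r j)\<^sup>2 * (norm (C j *v x))\<^sup>2)"
    by (simp only: SVD_system_norm_sum_scaleR[OF assms(1)])
  also have "\<dots> \<le> (\<Sum>j=1..s. M\<^sup>2 * (norm (C j *v x))\<^sup>2)"
    using r \<open>0 \<le> M\<close> by (intro sum_mono mult_right_mono) (auto simp: power2_le_iff_abs_le)
  also have "\<dots> = M\<^sup>2 * (\<Sum>j=1..s. (norm (C j *v x))\<^sup>2)"
    by (simp add: sum_distrib_left)
  also have "\<dots> \<le> M\<^sup>2 * (norm x)\<^sup>2"
    by (intro mult_left_mono SVD_system_Bessel[OF assms(1)]) auto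
  finally have "(norm ((\<Sum>j=1..s. r j *\<^sub>R C j) *v x))\<^sup>2 \<le> (M * norm x)\<^sup>2"
    by (simp add: power_mult_distrib)
  then show ?thesis
    using \<open>0 \<le> M\<close> by (simp add: power2_le_iff_abs_le)
qed

section \<open>Integer shifts along an SVD system and the equivalence\<close>

lemma SVD_system_commute:
  assumes "SVD_system s C" "i \<in> {1..s}" "j \<in> {1..s}"
  shows "C i ** C j = C j ** C i"
  using assms by (cases "i = j") (auto simp: SVD_system_def)

text \<open>The shift invariance on which both directions of the equivalence rest.\<close>

lemma SVD_system_matrix_exp_add:
  assumes C: "SVD_system s C" and "\<forall>j\<in>{1..s}. C j ** B = B ** C j"
  shows "matrix_exp (B + (2 * pi) *\<^sub>R (\<Sum>j=1..s. of_int (l j) *\<^sub>R C j)) = matrix_exp B"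
proof -
  have "(2 * pi) *\<^sub>R (\<Sum>j=1..s. of_int (l j) *\<^sub>R C j) = (\<Sum>j=1..s. (2 * pi * of_int (l j)) *\<^sub>R C j)"
    by (simp add: scaleR_right.sum)
  moreover have "C j ** (C j ** C j) = - C j" if "j \<in> {1..s}" for j
    using C that by (auto simp: SVD_system_def matrix_power_3_eq)
  ultimately show ?thesis
    using assms SVD_system_commute[OF C]
    by (simp only:) (rule matrix_exp_add_two_pi_ints; simp)
qed

text \<open>Rounding to the nearest integer errs by at most 1/2, which scales to \<open>pi\<close>;
  rounding down would only give a remainder below \<open>2 * pi\<close>.\<close>

lemma abs_reduce_two_pi: "\<bar>t - 2 * pi * of_int (round (t / (2 * pi)))\<bar> \<le> pi"
proof -
  let ?k = "of_int (round (t / (2 * pi))) :: real"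
  have "\<bar>t - 2 * pi * ?k\<bar> = 2 * pi * \<bar>?k - t / (2 * pi)\<bar>"
    by (simp add: abs_if field_simps)
  also have "\<dots> \<le> 2 * pi * (1 / 2)"
    by (intro mult_left_mono of_int_round_abs_le) simp
  finally show ?thesis by simp
qed

theorem theorem2p4:
  fixes R A :: "real ^ 'n ^ 'n"
  assumes "R \<in> special_orthogonal_group" and "skew_symmetric A"
  shows "skew_log R A \<longleftrightarrow>
    (\<exists>(B :: real ^ 'n ^ 'n) (s :: nat) (C :: nat \<Rightarrow> real ^ 'n ^ 'n) (l :: nat \<Rightarrow> int).
       principal_skew_log R B \<and>
       SVD_system s C \<and>
       (\<forall>j\<in>{1..s}. C j ** B = B ** C j) \<and>
       A = B + (2 * pi) *\<^sub>R (\<Sum>j=1..s. of_int (l j) *\<^sub>R C j))"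
    (is "_ \<longleftrightarrow> ?rhs")
proof
  assume log: "skew_log R A"
  obtain s C \<theta> where C: "SVD_system s C" and A: "A = (\<Sum>j=1..s. \<theta> j *\<^sub>R C j)"
    using skew_symmetric_decomposition[OF assms(2)] .
  define l where "l j = round (\<theta> j / (2 * pi))" for j
  define r where "r j = \<theta> j - 2 * pi * of_int (l j)" for j
  define B where "B = (\<Sum>j=1..s. r j *\<^sub>R C j)"
  have r: "\<bar>r j\<bar> \<le> pi" for j
    unfolding r_def l_def by (rule abs_reduce_two_pi)
  have comm: "\<forall>j\<in>{1..s}. C j ** B = B ** C j"
    by (auto simp: B_def matrix_mult.sum_left matrix_mult.sum_right matrix_mult.scaleR_left
        matrix_mult.scaleR_right intro!: sum.cong SVD_system_commute[OF C])
  have AB: "A = B + (2 * pi) *\<^sub>R (\<Sum>j=1..s. of_int (l j) *\<^sub>R C j)"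
    by (simp add: A B_def r_def scaleR_right.sum flip: sum.distrib scaleR_add_left)
  have "skew_symmetric B"
    unfolding B_def using C
    by (intro skew_symmetric_sum skew_symmetric_scaleR) (auto simp: SVD_system_def)
  moreover have "matrix_exp B = R"
    using SVD_system_matrix_exp_add[OF C comm, of l] log
    by (simp only: AB[symmetric] skew_log_def)
  \<comment> \<open>All coefficients of \<open>B\<close> are at most \<open>pi\<close> in absolute
    value, so \<open>B\<close> stretches no vector by more than \<open>pi\<close>.\<close>
  moreover have "cmod \<mu> \<le> pi" if "complex_eigenvalue B \<mu>" for \<mu>
    using SVD_system_norm_le[OF C r] that
    by (intro cmod_complex_eigenvalue_le[of B]) (auto simp: B_def)
  ultimately have "principal_skew_log R B"
    by (simp add: principal_skew_log_def skew_log_def)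
  with C comm AB show ?rhs by blast
next
  assume ?rhs
  then show "skew_log R A"
    using assms(2) SVD_system_matrix_exp_add
    by (auto simp: principal_skew_log_def skew_log_def)
qed

end
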